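(* Let $A$ be a finite set, let $X \subset A^{\mathbb{Z}}$ be a subshift of finite type, and let $\mathcal{C}$ denote the poset of irreducible components of $X$. Suppose that $\tau \colon X \to X$ is an injective endomorphism of $X$ and let $\rho = \rho_\tau \colon \mathcal{C} \to \mathcal{C}$ denote the poset endomorphism of $\mathcal{C}$ associated with $\tau$. Then the following hold: (i) one has $\tau(\mathrm{NW}(X)) = \mathrm{NW}(X)$ and $\tau$ induces by restriction a topological conjugacy of $\mathrm{NW}(X)$ onto itself; (ii) the map $\rho \colon \mathcal{C} \to \mathcal{C}$ is a poset automorphism of $\mathcal{C}$; (iii) for each $C \in \mathcal{C}$, one has $\tau(C) = \rho(C)$ and $\tau$ induces by restriction a topological conjugacy of $C$ onto $\rho(C)$; (iv) one has $\tau(X \setminus \mathrm{NW}(X)) \subset X \setminus \mathrm{NW}(X)$ and $\tau^{-1}(X \setminus \mathrm{NW}(X)) = X \setminus \mathrm{NW}(X)$; (v) $\tau$ is surjective if and only if $\tau(X \setminus \mathrm{NW}(X)) = X \setminus \mathrm{NW}(X)$.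
   Context: $A^{\mathbb{Z}}$ carries the product topology ($A$ discrete) and the shift homeomorphism $\sigma$, $(\sigma(x))_i = x_{i+1}$. A subshift is a closed subset $X\subset A^{\mathbb{Z}}$ with $\sigma(X)=X$. It is of finite type if there are an integer $n\ge 0$ and $S\subset A^n$ such that $X$ is the set of all $x\in A^{\mathbb{Z}}$ with $(x_{i+1},\dots,x_{i+n})\in S$ for all $i\in\mathbb{Z}$. An endomorphism of $X$ is a continuous map $\tau\colon X\to X$ commuting with $\sigma$. A topological conjugacy between subshifts is a homeomorphism commuting with the shifts. $\mathrm{NW}(X)$ is the set of $x\in X$ such that for every neighborhood $U$ of $x$ in $X$ there is $n\ge1$ with $U\cap\sigma^n(U)\neq\varnothing$. A subshift $Y$ is irreducible if it is non-empty and for all non-empty open $U,W\subset Y$ there is $n\ge 1$ with $U\cap\sigma^n(W)\ne\varnothing$. For a subshift of finite type $X$, there is a unique finite partition $\mathcal{C}$ of $\mathrm{NW}(X)$ into irreducible subshifts; its elements are the irreducible components of $X$. For $x\in X$, $\alpha(x)$ (resp. $\omega(x)$) is the set of limits of convergent sequences $(\sigma^{-n_k}(x))_k$ (resp. $(\sigma^{n_k}(x))_k$) with $(n_k)$ a strictly increasing sequence of non-negative integers; there are unique $C_\alpha(x),C_\omega(x)\in\mathcal{C}$ with $\alpha(x)\subset C_\alpha(x)$, $\omega(x)\subset C_\omega(x)$. $\mathcal{C}$ is partially ordered by: $C\preceq C'$ iff there is $x\in X$ with $C_\alpha(x)=C$ and $C_\omega(x)=C'$. For an endomorphism $\tau$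 of $X$, $\rho_\tau\colon\mathcal{C}\to\mathcal{C}$ is the unique map with $\tau(C)\subset\rho_\tau(C)$ for all $C\in\mathcal{C}$; it is order-preserving. *)

theory Defs
  imports "HOL-Analysis.Analysis" "HOL-Library.Disjoint_Sets"
begin

definition full_shift :: "'a set \<Rightarrow> (int \<Rightarrow> 'a) topology" where
  "full_shift A = product_topology (\<lambda>_. discrete_topology A) UNIV"

abbreviation subshift_top :: "'a set \<Rightarrow> (int \<Rightarrow> 'a) set \<Rightarrow> (int \<Rightarrow> 'a) topology" where
  "subshift_top A X \<equiv> subtopology (full_shift A) X"

definition shift_map :: "(int \<Rightarrow> 'a) \<Rightarrow> (int \<Rightarrow> 'a)" where
  "shift_map x = (\<lambda>i. x (i + 1))"

definition subshift :: "'a set \<Rightarrow> (int \<Rightarrow> 'a) set \<Rightarrow> bool" where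
  "subshift A X \<longleftrightarrow> closedin (full_shift A) X \<and> shift_map ` X = X"

definition subshift_of_finite_type :: "'a set \<Rightarrow> (int \<Rightarrow> 'a) set \<Rightarrow> bool" where
  "subshift_of_finite_type A X \<longleftrightarrow> subshift A X \<and>
     (\<exists>n::nat. \<exists>S \<subseteq> {w \<in> lists A. length w = n}.
        X = {x \<in> topspace (full_shift A).
               \<forall>i. map (\<lambda>k. x (i + int k)) [1..<Suc n] \<in> S})"

definition subshift_endomorphism ::
    "'a set \<Rightarrow> (int \<Rightarrow> 'a) set \<Rightarrow> ((int \<Rightarrow> 'a) \<Rightarrow> (int \<Rightarrow> 'a)) \<Rightarrow> bool" where
  "subshift_endomorphism A X \<tau> \<longleftrightarrow>
     continuous_map (subshift_top A X) (subshift_top A X) \<tau> \<and>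
     (\<forall>x\<in>X. \<tau> (shift_map x) = shift_map (\<tau> x))"

text \<open>All conditions on \<open>f\<close> depend only on its values on \<open>X\<close>, so applying this to a map defined
  on a larger set expresses that its restriction to \<open>X\<close> is a conjugacy.\<close>

definition topological_conjugacy ::
    "'a set \<Rightarrow> (int \<Rightarrow> 'a) set \<Rightarrow> (int \<Rightarrow> 'a) set \<Rightarrow> ((int \<Rightarrow> 'a) \<Rightarrow> (int \<Rightarrow> 'a)) \<Rightarrow> bool" where
  "topological_conjugacy A X Y f \<longleftrightarrow> subshift A X \<and> subshift A Y \<and>
     homeomorphic_map (subshift_top A X) (subshift_top A Y) f \<and>
     (\<forall>x\<in>X. f (shift_map x) = shift_map (f x))"

definition NW :: "'a set \<Rightarrow> (int \<Rightarrow> 'a) set \<Rightarrow> (int \<Rightarrow> 'a) set" where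
  "NW A X = {x \<in> X. \<forall>U. U \<subseteq> X \<and> (\<exists>V. openin (subshift_top A X) V \<and> x \<in> V \<and> V \<subseteq> U)
     \<longrightarrow> (\<exists>n\<ge>1. U \<inter> (shift_map ^^ n) ` U \<noteq> {})}"

definition irreducible_subshift :: "'a set \<Rightarrow> (int \<Rightarrow> 'a) set \<Rightarrow> bool" where
  "irreducible_subshift A Y \<longleftrightarrow> subshift A Y \<and> Y \<noteq> {} \<and>
     (\<forall>U W. openin (subshift_top A Y) U \<and> openin (subshift_top A Y) W \<and> U \<noteq> {} \<and> W \<noteq> {}
        \<longrightarrow> (\<exists>n\<ge>1. U \<inter> (shift_map ^^ n) ` W \<noteq> {}))"

definition irreducible_components :: "'a set \<Rightarrow> (int \<Rightarrow> 'a) set \<Rightarrow> (int \<Rightarrow> 'a) set set" where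
  "irreducible_components A X =
     (THE P. finite P \<and> partition_on (NW A X) P \<and> (\<forall>C\<in>P. irreducible_subshift A C))"

definition alpha_limit :: "'a set \<Rightarrow> (int \<Rightarrow> 'a) \<Rightarrow> (int \<Rightarrow> 'a) set" where
  "alpha_limit A x = {y. \<exists>n::nat \<Rightarrow> nat. strict_mono n \<and>
     limitin (full_shift A) (\<lambda>k. (inv shift_map ^^ n k) x) y sequentially}"

definition omega_limit :: "'a set \<Rightarrow> (int \<Rightarrow> 'a) \<Rightarrow> (int \<Rightarrow> 'a) set" where
  "omega_limit A x = {y. \<exists>n::nat \<Rightarrow> nat. strict_mono n \<and>
     limitin (full_shift A) (\<lambda>k. (shift_map ^^ n k) x) y sequentially}"

definition alpha_component :: "'a set \<Rightarrow> (int \<Rightarrow> 'a) set \<Rightarrow> (int \<Rightarrow> 'a) \<Rightarrow> (int \<Rightarrow> 'a) set" where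
  "alpha_component A X x = (THE C. C \<in> irreducible_components A X \<and> alpha_limit A x \<subseteq> C)"

definition omega_component :: "'a set \<Rightarrow> (int \<Rightarrow> 'a) set \<Rightarrow> (int \<Rightarrow> 'a) \<Rightarrow> (int \<Rightarrow> 'a) set" where
  "omega_component A X x = (THE C. C \<in> irreducible_components A X \<and> omega_limit A x \<subseteq> C)"

definition component_le ::
    "'a set \<Rightarrow> (int \<Rightarrow> 'a) set \<Rightarrow> (int \<Rightarrow> 'a) set \<Rightarrow> (int \<Rightarrow> 'a) set \<Rightarrow> bool" where
  "component_le A X C C' \<longleftrightarrow>
     (\<exists>x\<in>X. alpha_component A X x = C \<and> omega_component A X x = C')"

definition component_map ::
    "'a set \<Rightarrow> (int \<Rightarrow> 'a) set \<Rightarrow> ((int \<Rightarrow> 'a) \<Rightarrow> (int \<Rightarrow> 'a)) \<Rightarrow> (int \<Rightarrow> 'a) set \<Rightarrow> (int \<Rightarrow> 'a) set" where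
  "component_map A X \<tau> C = (THE C'. C' \<in> irreducible_components A X \<and> \<tau> ` C \<subseteq> C')"

definition poset_automorphism :: "'b set \<Rightarrow> ('b \<Rightarrow> 'b \<Rightarrow> bool) \<Rightarrow> ('b \<Rightarrow> 'b) \<Rightarrow> bool" where
  "poset_automorphism P le f \<longleftrightarrow> bij_betw f P P \<and>
     (\<forall>x\<in>P. \<forall>y\<in>P. le x y \<longleftrightarrow> le (f x) (f y))"

end

theory Submission imports Defs begin

text \<open>
  Two points of a shift of finite type that share a long enough word can be glued along it, so the
  shift is governed by reachability between words of the defining length. The non-wandering points
  are those all of whose words are mutually reachable; the irreducible components are the
  communicating classes; and closing up such points shows that periodic points are dense in the
  non-wandering set. An injective endomorphism permutes the finite set of points of each period, so
  by density and compactness it maps the non-wandering set onto itself. Hence the induced map on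
  the finite set of components is surjective, therefore bijective, and each component is mapped
  onto a whole component.
\<close>

section \<open>Topology of the full shift\<close>

text \<open>\<open>\<tau>\<close> need not map \<open>X\<close> onto \<open>X\<close>, so its
  inverse is not an endomorphism of \<open>X\<close>, and order preservation cannot simply be
  applied to it: a point that witnesses the order between two image components may have no preimage.
  Every converse direction is therefore obtained by finiteness, from the points of a given period,
  from the set of components, or from the set of comparable pairs. The components, the components of
  limit sets and the map \<open>\<rho>\<close> are all introduced by \<open>THE\<close>, so each
  rests on a proof of unique existence. Two of these proofs are instances of one fact about maps
  from an irreducible subshift into a finite disjoint family of subshifts. A window at
  \<open>i\<close> occupies the positions \<open>i + 1\<close> to \<open>i + n\<close>, as in the
  definition of finite type; the recurring offsets by one come from there.\<close>

definition window :: "nat \<Rightarrow> (int \<Rightarrow> 'a) \<Rightarrow> int \<Rightarrow> 'a list" where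
  "window n x i = map (\<lambda>k. x (i + int k)) [1..<Suc n]"

text \<open>All integer powers of the shift form one family with an additive law, so iterates of
  \<open>shift_map\<close> and of its inverse are handled alike.\<close>

definition translate :: "int \<Rightarrow> (int \<Rightarrow> 'a) \<Rightarrow> (int \<Rightarrow> 'a)" where
  "translate m x = (\<lambda>i. x (i + m))"

lemma window_eq_iff:
  "window n x i = window n y j \<longleftrightarrow> (\<forall>k. 0 < k \<and> k \<le> int n \<longrightarrow> x (i + k) = y (j + k))"
proof -
  have "window n x i = window n y j \<longleftrightarrow> (\<forall>k\<in>{1..<Suc n}. x (i + int k) = y (j + int k))"
    unfolding window_def by (auto simp del: upt_Suc)
  also have "\<dots> \<longleftrightarrow> (\<forall>k. 0 < k \<and> k \<le> int n \<longrightarrow> x (i + k) = y (j + k))"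
  proof (intro iffI allI impI ballI)
    fix k assume H: "\<forall>k\<in>{1..<Suc n}. x (i + int k) = y (j + int k)" and k: "0 < k \<and> k \<le> int n"
    then have "nat k \<in> {1..<Suc n}" by auto
    with H have "x (i + int (nat k)) = y (j + int (nat k))" by blast
    with k show "x (i + k) = y (j + k)" by simp
  qed auto
  finally show ?thesis .
qed

lemma window_translate: "window n (translate m x) i = window n x (i + m)"
  by (simp add: window_eq_iff translate_def add_ac)

lemma translate_0 [simp]: "translate 0 x = x"
  by (simp add: translate_def)

lemma translate_translate: "translate m (translate n x) = translate (m + n) x"
  by (simp add: translate_def add_ac)

lemma shift_map_eq_translate: "shift_map = translate 1"
  by (simp add: shift_map_def translate_def fun_eq_iff)

lemma funpow_shift_map: "(shift_map ^^ n) x = translate (int n) x"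
  by (induction n) (simp_all add: shift_map_eq_translate translate_translate)

lemma inv_shift_map: "inv shift_map = translate (-1)"
  unfolding shift_map_eq_translate
  by (rule inv_unique_comp) (simp_all add: fun_eq_iff translate_translate)

lemma funpow_inv_shift_map: "(inv shift_map ^^ n) x = translate (- int n) x"
  by (induction n) (simp_all add: inv_shift_map translate_translate)

lemma topspace_full_shift: "x \<in> topspace (full_shift A) \<longleftrightarrow> (\<forall>i. x i \<in> A)"
  by (auto simp: full_shift_def)

lemma compact_space_full_shift: "finite A \<Longrightarrow> compact_space (full_shift A)"
  by (simp add: full_shift_def compact_space_product_topology compact_space_discrete_topology)

lemma Hausdorff_space_full_shift: "Hausdorff_space (full_shift A)"
  by (simp add: full_shift_def Hausdorff_space_product_topology Hausdorff_space_discrete_topology)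

lemma metrizable_space_full_shift: "metrizable_space (full_shift A)"
  by (simp add: full_shift_def metrizable_space_product_topology metrizable_space_discrete_topology)

text \<open>Pinning the coordinates in \<open>F\<close> to those of a given point yields a basic
  open box, and locality of \<open>Q\<close> keeps the box inside the set. The negation of
  \<open>Q\<close> is just as local, so such sets are clopen.\<close>

lemma openin_full_shift_local:
  assumes "finite F"
    and local: "\<And>x y. (\<And>i. i \<in> F \<Longrightarrow> x i = y i) \<Longrightarrow> Q x \<longleftrightarrow> Q y"
  shows "openin (full_shift A) {x \<in> topspace (full_shift A). Q x}"
proof (subst openin_subopen, intro ballI)
  fix x assume x: "x \<in> {x \<in> topspace (full_shift A). Q x}"
  define T where "T = (\<Pi>\<^sub>E i\<in>UNIV. if i \<in> F then {x i} else A)"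
  have "openin (full_shift A) T"
    unfolding full_shift_def T_def
  proof (rule product_topology_basis)
    show "openin (discrete_topology A) (if i \<in> F then {x i} else A)" for i
      using x by (simp add: topspace_full_shift)
    have "{i. (if i \<in> F then {x i} else A) \<noteq> topspace (discrete_topology A)} \<subseteq> F"
      by auto
    then show "finite {i. (if i \<in> F then {x i} else A) \<noteq> topspace (discrete_topology A)}"
      using \<open>finite F\<close> finite_subset by blast
  qed
  moreover have "x \<in> T"
    using x by (auto simp: T_def topspace_full_shift)
  moreover have "y \<in> {x \<in> topspace (full_shift A). Q x}" if "y \<in> T" for y
  proof -
    have y: "y i \<in> (if i \<in> F then {x i} else A)" for i
      using that by (auto simp: T_def PiE_iff)
    have "y i = x i" if "i \<in> F" for i using y[of i] that by simp
    then have "Q y" using local[of y x] x by blast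
    moreover have "y i \<in> A" for i
      using y[of i] x by (auto simp: topspace_full_shift split: if_splits)
    ultimately show ?thesis by (simp add: topspace_full_shift)
  qed
  ultimately show "\<exists>T. openin (full_shift A) T \<and> x \<in> T \<and> T \<subseteq> {x \<in> topspace (full_shift A). Q x}"
    by blast
qed

lemma closedin_full_shift_local:
  assumes "finite F"
    and local: "\<And>x y. (\<And>i. i \<in> F \<Longrightarrow> x i = y i) \<Longrightarrow> Q x \<longleftrightarrow> Q y"
  shows "closedin (full_shift A) {x \<in> topspace (full_shift A). Q x}"
proof -
  have "openin (full_shift A) {x \<in> topspace (full_shift A). \<not> Q x}"
    by (rule openin_full_shift_local[OF \<open>finite F\<close>]) (use local in blast)
  moreover have "topspace (full_shift A) - {x \<in> topspace (full_shift A). Q x}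
      = {x \<in> topspace (full_shift A). \<not> Q x}" by auto
  ultimately show ?thesis by (simp add: closedin_def)
qed

lemma window_local:
  assumes "\<And>k. k \<in> {i..i + int n} \<Longrightarrow> x k = y k"
  shows "window n x i = window n y i"
  using assms by (auto simp: window_eq_iff)

lemma closedin_full_shift_windows:
  "closedin (full_shift A) {x \<in> topspace (full_shift A). \<forall>i. Q (window n x i)}"
proof -
  have "{x \<in> topspace (full_shift A). \<forall>i. Q (window n x i)}
      = (\<Inter>i. {x \<in> topspace (full_shift A). Q (window n x i)})" by auto
  moreover have "closedin (full_shift A) {x \<in> topspace (full_shift A). Q (window n x i)}" for i
    by (rule closedin_full_shift_local[of "{i..i + int n}"]) (simp, metis window_local)
  ultimately show ?thesis by (auto intro: closedin_Inter)
qed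

lemma openin_full_shift_cylinder:
  assumes "openin (full_shift A) U" "x \<in> U"
  obtains m :: int where "0 \<le> m"
    "\<And>y. y \<in> topspace (full_shift A) \<Longrightarrow> (\<And>i. \<bar>i\<bar> \<le> m \<Longrightarrow> y i = x i) \<Longrightarrow> y \<in> U"
proof -
  obtain B where B: "finite {i. B i \<noteq> A}" "x \<in> (\<Pi>\<^sub>E i\<in>UNIV. B i)" "(\<Pi>\<^sub>E i\<in>UNIV. B i) \<subseteq> U"
    using product_topology_open_contains_basis[OF assms[unfolded full_shift_def]] by auto
  \<comment> \<open>The inserted 0 keeps the maximum defined, and the radius non-negative, when no
    coordinate is constrained.\<close>
  define m where "m = Max (insert 0 (abs ` {i. B i \<noteq> A}))"
  have m: "\<bar>i\<bar> \<le> m" if "B i \<noteq> A" for i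
    unfolding m_def using B(1) that by (intro Max_ge) auto
  have "0 \<le> m" unfolding m_def using B(1) by (intro Max_ge) auto
  moreover have "y \<in> U" if y: "y \<in> topspace (full_shift A)" "\<And>i. \<bar>i\<bar> \<le> m \<Longrightarrow> y i = x i" for y
  proof -
    have "y i \<in> B i" for i
    proof (cases "B i = A")
      case True then show ?thesis using y(1) by (simp add: topspace_full_shift)
    next
      case False then show ?thesis using y(2)[OF m] B(2) by (auto simp: PiE_iff)
    qed
    then show ?thesis using B(3) by auto
  qed
  ultimately show thesis using that by blast
qed

lemma openin_subshift_cylinder:
  assumes "openin (subshift_top A X) U" "x \<in> U"
  obtains m :: int where "0 \<le> m"
    "\<And>y. y \<in> X \<Longrightarrow> y \<in> topspace (full_shift A) \<Longrightarrow> (\<And>i. \<bar>i\<bar> \<le> m \<Longrightarrow> y i = x i) \<Longrightarrow> y \<in> U"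
proof -
  obtain V where V: "openin (full_shift A) V" "U = V \<inter> X"
    using assms(1) by (auto simp: openin_subtopology)
  with assms(2) obtain m where "0 \<le> m"
    "\<And>y. y \<in> topspace (full_shift A) \<Longrightarrow> (\<And>i. \<bar>i\<bar> \<le> m \<Longrightarrow> y i = x i) \<Longrightarrow> y \<in> V"
    using openin_full_shift_cylinder[of A V x] by blast
  then show thesis using that V(2) by blast
qed

text \<open>Open sets suffice, because a return inside an open \<open>V\<close> is also a return
  inside every larger neighborhood. A set meeting its own image becomes a concrete point
  \<open>z\<close> with its translate.\<close>

lemma NW_iff:
  "x \<in> NW A X \<longleftrightarrow> x \<in> X \<and> (\<forall>V. openin (subshift_top A X) V \<and> x \<in> V
     \<longrightarrow> (\<exists>n\<ge>1. \<exists>z\<in>V. translate (int n) z \<in> V))"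
proof -
  have "(\<exists>n\<ge>1. V \<inter> (shift_map ^^ n) ` V \<noteq> {}) \<longleftrightarrow> (\<exists>n\<ge>1. \<exists>z\<in>V. translate (int n) z \<in> V)"
    for V :: "(int \<Rightarrow> 'a) set"
    by (auto simp: funpow_shift_map)
  note ret = this
  show ?thesis
  proof (intro iffI conjI allI impI)
    show "x \<in> X" if "x \<in> NW A X" using that by (simp add: NW_def)
    show "\<exists>n\<ge>1. \<exists>z\<in>V. translate (int n) z \<in> V"
      if "x \<in> NW A X" "openin (subshift_top A X) V \<and> x \<in> V" for V
    proof -
      have "V \<subseteq> X \<and> (\<exists>W. openin (subshift_top A X) W \<and> x \<in> W \<and> W \<subseteq> V)"
        using that(2) openin_imp_subset by blast
      then show ?thesis using that(1) unfolding NW_def ret mem_Collect_eq by presburger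
    qed
    assume R: "x \<in> X \<and> (\<forall>V. openin (subshift_top A X) V \<and> x \<in> V
      \<longrightarrow> (\<exists>n\<ge>1. \<exists>z\<in>V. translate (int n) z \<in> V))"
    show "x \<in> NW A X"
      unfolding NW_def ret
    proof (intro CollectI conjI allI impI)
      fix U assume "U \<subseteq> X \<and> (\<exists>V. openin (subshift_top A X) V \<and> x \<in> V \<and> V \<subseteq> U)"
      then obtain V where "openin (subshift_top A X) V" "x \<in> V" "V \<subseteq> U" by blast
      with R obtain n z where "n \<ge> 1" "z \<in> V" "translate (int n) z \<in> V" by blast
      with \<open>V \<subseteq> U\<close> show "\<exists>n\<ge>1. \<exists>z\<in>U. translate (int n) z \<in> U" by blast
    qed (use R in simp)
  qed
qed

section \<open>Subshifts through arbitrary integer translates\<close>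

lemma subshift_translate:
  assumes "subshift A X" "x \<in> X"
  shows "translate m x \<in> X"
proof -
  have img: "translate 1 ` X = X"
    using assms(1) by (simp add: subshift_def shift_map_eq_translate)
  have fwd: "translate (int n) y \<in> X" if "y \<in> X" for n y
    using that
  proof (induction n)
    case (Suc n)
    have "translate (int (Suc n)) y = translate 1 (translate (int n) y)"
      by (simp add: translate_translate add.commute)
    then show ?case using Suc img by blast
  qed simp
  have bwd: "translate (- int n) y \<in> X" if "y \<in> X" for n y
    using that
  proof (induction n)
    case (Suc n)
    then obtain z where "z \<in> X" "translate (- int n) y = translate 1 z" using img by blast
    then have "translate (- int (Suc n)) y = translate (-1) (translate 1 z)"
      by (metis add.commute minus_add_distrib of_nat_Suc translate_translate)
    then show ?case using \<open>z \<in> X\<close> by (simp add: translate_translate)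
  qed simp
  show ?thesis
    using fwd[OF assms(2), of "nat m"] bwd[OF assms(2), of "nat (- m)"] by (cases "0 \<le> m") auto
qed

lemma subshiftI:
  assumes "closedin (full_shift A) X" "\<And>x m. x \<in> X \<Longrightarrow> translate m x \<in> X"
  shows "subshift A X"
  unfolding subshift_def shift_map_eq_translate
proof (intro conjI assms(1) equalityI subsetI)
  fix x assume "x \<in> X"
  then have "translate (-1) x \<in> X" "translate 1 (translate (-1) x) = x"
    by (simp_all add: assms(2) translate_translate)
  then show "x \<in> translate 1 ` X" by force
qed (auto intro: assms(2))

lemma subshift_subset_topspace: "subshift A X \<Longrightarrow> X \<subseteq> topspace (full_shift A)"
  by (simp add: subshift_def closedin_subset)

lemma topspace_subshift_top: "subshift A X \<Longrightarrow> topspace (subshift_top A X) = X"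
  using subshift_subset_topspace by (auto simp: topspace_subtopology)

lemma compact_space_subshift: "finite A \<Longrightarrow> subshift A X \<Longrightarrow> compact_space (subshift_top A X)"
  by (metis closedin_compact_space compact_space_full_shift compact_space_subtopology subshift_def)

section \<open>Reachability between words\<close>

locale finite_type_shift =
  fixes A :: "'a set" and X :: "(int \<Rightarrow> 'a) set" and N :: nat and S :: "'a list set"
  assumes finite_alphabet: "finite A"
    and shift_eq: "X = {x \<in> topspace (full_shift A). \<forall>i. window N x i \<in> S}"
begin

lemma mem_shift_iff: "x \<in> X \<longleftrightarrow> (\<forall>i. x i \<in> A) \<and> (\<forall>i. window N x i \<in> S)"
  by (simp add: shift_eq topspace_full_shift)

lemma mem_topspace: "x \<in> X \<Longrightarrow> x \<in> topspace (full_shift A)"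
  by (simp add: shift_eq)

lemma subshift_X: "subshift A X"
proof (rule subshiftI)
  show "closedin (full_shift A) X"
    unfolding shift_eq by (rule closedin_full_shift_windows)
  show "translate m x \<in> X" if "x \<in> X" for x m
    using that unfolding mem_shift_iff window_translate by (simp add: translate_def)
qed

text \<open>Existence of a path in the graph whose vertices are the words of length \<open>N\<close>
  occurring in points of \<open>X\<close>. Allowing \<open>a = b\<close> makes the relation
  reflexive on these words.\<close>

definition reach :: "'a list \<Rightarrow> 'a list \<Rightarrow> bool" where
  "reach v w \<longleftrightarrow> (\<exists>y\<in>X. \<exists>a b. a \<le> b \<and> window N y a = v \<and> window N y b = w)"

lemma reachI: "y \<in> X \<Longrightarrow> a \<le> b \<Longrightarrow> reach (window N y a) (window N y b)"
  unfolding reach_def by blast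

text \<open>The common window makes the two halves overlap in \<open>N\<close> symbols. Windows of
  \<open>z\<close> at positions up to \<open>i\<close> then lie in the part equal to
  \<open>x\<close>, later ones in the part copied from \<open>y\<close>, so no forbidden word
  appears at the seam.\<close>

lemma glue:
  assumes "x \<in> X" "y \<in> X" and eq: "window N x i = window N y j"
  obtains z where "z \<in> X" "\<And>k. k \<le> i + int N \<Longrightarrow> z k = x k"
    "\<And>k. i < k \<Longrightarrow> z k = y (k - i + j)"
    "\<And>k. k \<le> i \<Longrightarrow> window N z k = window N x k"
    "\<And>k. i \<le> k \<Longrightarrow> window N z k = window N y (k - i + j)"
proof -
  define z where "z k = (if k \<le> i then x k else y (k - i + j))" for k
  have right: "z k = y (k - i + j)" if "i < k" for k
    using that by (simp add: z_def)
  have left: "z k = x k" if "k \<le> i + int N" for k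
  proof (cases "k \<le> i")
    case False
    then have "x (i + (k - i)) = y (j + (k - i))"
      using eq[unfolded window_eq_iff, rule_format, of "k - i"] that by simp
    then show ?thesis using False by (simp add: z_def add.commute)
  qed (simp add: z_def)
  have wl: "window N z k = window N x k" if "k \<le> i" for k
    using that by (simp add: window_eq_iff left)
  have wr: "window N z k = window N y (k - i + j)" if "i \<le> k" for k
    using that by (simp add: window_eq_iff right algebra_simps)
  have "window N z k \<in> S" for k
    using wl[of k] wr[of k] assms(1,2) unfolding mem_shift_iff by (cases "k \<le> i") auto
  moreover have "z k \<in> A" for k
    using assms(1,2) by (simp add: z_def mem_shift_iff)
  ultimately have "z \<in> X" by (simp add: mem_shift_iff)
  then show thesis using that left right wl wr by blast
qed

lemma reach_trans: "reach u v \<Longrightarrow> reach v w \<Longrightarrow> reach u w"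
proof -
  assume "reach u v" "reach v w"
  then obtain y a b y' a' b' where y: "y \<in> X" "a \<le> b" "window N y a = u" "window N y b = v"
    and y': "y' \<in> X" "a' \<le> b'" "window N y' a' = v" "window N y' b' = w"
    unfolding reach_def by metis
  obtain z where "z \<in> X" and l: "\<And>k. k \<le> b \<Longrightarrow> window N z k = window N y k"
    and r: "\<And>k. b \<le> k \<Longrightarrow> window N z k = window N y' (k - b + a')"
    using glue[OF y(1) y'(1)] y(4) y'(3) by metis
  moreover have "window N z a = u" using l y by simp
  moreover have "window N z (b + (b' - a')) = w" using r[of "b + (b' - a')"] y' by simp
  moreover have "a \<le> b + (b' - a')" using y(2) y'(2) by simp
  ultimately show "reach u w" unfolding reach_def by blast
qed

text \<open>The block at positions \<open>i + 1\<close> to \<open>j\<close> is repeated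
  periodically. Equal windows at both ends make \<open>x\<close> continue past the block, for
  \<open>N\<close> symbols, exactly as the repetition does, so every window of \<open>p\<close> is
  already a window of \<open>x\<close>.\<close>

lemma close_up:
  assumes "x \<in> X" "i < j" and eq: "window N x i = window N x j"
  obtains p where "p \<in> X" "translate (j - i) p = p" "\<And>k. i < k \<Longrightarrow> k \<le> j \<Longrightarrow> p k = x k"
proof -
  define d where "d = j - i"
  have d: "0 < d" using assms(2) by (simp add: d_def)
  define p where "p k = x (i + 1 + (k - i - 1) mod d)" for k
  have base: "p k = x k" if "i < k" "k \<le> j" for k
    using that by (simp add: p_def d_def)
  have per: "p (k + q * d) = p k" for k q
  proof -
    have "k + q * d - i - 1 = (k - i - 1) + q * d" by simp
    then show ?thesis unfolding p_def by (simp only: mod_mult_self1)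
  qed
  \<comment> \<open>\<open>N\<close> may exceed the period \<open>d\<close>, so one comparison of
    windows does not cover the range; the induction goes back by a full period each time.\<close>
  have agree: "p (i + 1 + int r) = x (i + 1 + int r)" if "int r < d + int N" for r
    using that
  proof (induction r rule: less_induct)
    case (less r)
    show ?case
    proof (cases "int r < d")
      case True
      then show ?thesis using base[of "i + 1 + int r"] by (simp add: d_def)
    next
      case False
      define s where "s = nat (int r - d)"
      have s: "int r = int s + d" "s < r" "int s < int N"
        using False d less.prems by (auto simp: s_def)
      have "p (i + 1 + int r) = p (i + 1 + int s)"
        using per[of "i + 1 + int s" 1] s(1) by (simp add: algebra_simps)
      also have "\<dots> = x (i + (1 + int s))"
        using less.IH[of s] s d by (simp add: add.assoc)
      also have "\<dots> = x (j + (1 + int s))"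
        using eq s(3) unfolding window_eq_iff by simp
      also have "\<dots> = x (i + 1 + int r)"
        using s(1) by (simp add: d_def algebra_simps)
      finally show ?thesis .
    qed
  qed
  have "window N p t \<in> S" for t
  proof -
    define r where "r = (t - i) mod d"
    have r: "0 \<le> r" "r < d" using d by (simp_all add: r_def)
    \<comment> \<open>Modulo the period, every window of \<open>p\<close> can be read at some
      \<open>i + r\<close> with \<open>0 \<le> r < d\<close>, where it lies in the range covered by
      \<open>agree\<close>.\<close>
    have t: "t = (i + r) + ((t - i) div d) * d"
      using div_mult_mod_eq[of "t - i" d] by (simp add: r_def algebra_simps)
    have "window N p t = window N x (i + r)"
      unfolding window_eq_iff
    proof (intro allI impI)
      fix k :: int assume k: "0 < k \<and> k \<le> int N"
      have "p (t + k) = p (i + r + k)"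
        using per[of "i + r + k" "(t - i) div d"] t by (metis add.commute add.left_commute)
      also have "\<dots> = p (i + 1 + int (nat (r + k - 1)))" using r k by (simp add: add.assoc)
      also have "\<dots> = x (i + 1 + int (nat (r + k - 1)))" using r k by (intro agree) simp
      also have "\<dots> = x (i + r + k)" using r k by (simp add: add.assoc)
      finally show "p (t + k) = x (i + r + k)" .
    qed
    then show ?thesis using assms(1) by (simp add: mem_shift_iff)
  qed
  moreover have "p k \<in> A" for k
    using assms(1) by (simp add: p_def mem_shift_iff)
  ultimately have "p \<in> X" by (simp add: mem_shift_iff)
  moreover have "translate (j - i) p = p"
    using per[of _ 1] by (simp add: translate_def d_def fun_eq_iff)
  ultimately show thesis using that base by blast
qed

text \<open>Follow \<open>x\<close> across the centre, take a path from there back to the word of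
  \<open>x\<close> just before the centre, and close up the resulting loop.\<close>

lemma periodic_approximation:
  assumes "x \<in> X" "\<And>i j. reach (window N x i) (window N x j)" "0 \<le> m"
  obtains p n where "p \<in> X" "n \<ge> 1" "translate (int n) p = p" "\<And>i. \<bar>i\<bar> \<le> m \<Longrightarrow> p i = x i"
proof -
  \<comment> \<open>The block that gets closed up starts right after \<open>- m - 1\<close>, that is
    at \<open>- m\<close>, and so contains all positions from \<open>- m\<close> to
    \<open>m\<close>.\<close>
  obtain y a b where y: "y \<in> X" "a \<le> b" "window N y a = window N x m"
      "window N y b = window N x (- m - 1)"
    using assms(2)[of m "- m - 1"] unfolding reach_def by blast
  obtain z where z: "z \<in> X" "\<And>k. k \<le> m + int N \<Longrightarrow> z k = x k"
    and l: "\<And>k. k \<le> m \<Longrightarrow> window N z k = window N x k"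
    and r: "\<And>k. m \<le> k \<Longrightarrow> window N z k = window N y (k - m + a)"
    using glue[OF assms(1) y(1) y(3)[symmetric]] by metis
  have w: "window N z (- m - 1) = window N z (m + (b - a))"
    using l[of "- m - 1"] r[of "m + (b - a)"] y(2,4) assms(3) by simp
  have "- m - 1 < m + (b - a)" using y(2) assms(3) by simp
  then obtain p where p: "p \<in> X" "translate (m + (b - a) - (- m - 1)) p = p"
      "\<And>k. - m - 1 < k \<Longrightarrow> k \<le> m + (b - a) \<Longrightarrow> p k = z k"
    using close_up[OF z(1) _ w] by blast
  show thesis
  proof (rule that[OF p(1)])
    show "1 \<le> nat (m + (b - a) - (- m - 1))" using y(2) assms(3) by simp
    show "translate (int (nat (m + (b - a) - (- m - 1)))) p = p"
      using p(2) y(2) assms(3) by simp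
    show "p i = x i" if "\<bar>i\<bar> \<le> m" for i
      using that p(3)[of i] z(2)[of i] y(2) by auto
  qed
qed

text \<open>Only reaching an earlier position takes an argument: a point near \<open>x\<close> that
  comes back near \<open>x\<close> supplies the way. Conversely, mutual reachability puts a periodic
  point into every neighborhood, and that point returns.\<close>

lemma mem_NW_iff: "x \<in> NW A X \<longleftrightarrow> x \<in> X \<and> (\<forall>i j. reach (window N x i) (window N x j))"
proof (intro iffI conjI allI)
  assume x: "x \<in> NW A X"
  then show xX: "x \<in> X" by (simp add: NW_iff)
  fix i j
  show "reach (window N x i) (window N x j)"
  proof (cases "i \<le> j")
    case True then show ?thesis using xX by (simp add: reachI)
  next
    case False
    define F where "F = {j..i + int N}"
    define V where "V = {y \<in> topspace (full_shift A). \<forall>k\<in>F. y k = x k} \<inter> X"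
    have "openin (full_shift A) {y \<in> topspace (full_shift A). \<forall>k\<in>F. y k = x k}"
      by (rule openin_full_shift_local[of F]) (auto simp: F_def)
    then have "openin (subshift_top A X) V" unfolding V_def by (rule openin_subtopology_Int)
    moreover have "x \<in> V" using xX mem_topspace by (simp add: V_def)
    ultimately obtain n z where n: "n \<ge> 1" and z: "z \<in> V" "translate (int n) z \<in> V"
      using x unfolding NW_iff by blast
    have zX: "z \<in> X" using z by (simp add: V_def)
    have w: "window N y k = window N x k" if "y \<in> V" "j \<le> k" "k \<le> i" for y k
      using that by (auto simp: V_def F_def window_eq_iff)
    \<comment> \<open>The return time \<open>n\<close> can be at most the distance \<open>l\<close>.
      Then the windows of \<open>x\<close> at \<open>i - l\<close> and at \<open>n\<close> places
      further right both equal one window of \<open>z\<close>, and induction applies. If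
      \<open>n > l\<close>, then \<open>z\<close> itself runs forward from the word at
      \<open>i\<close> to the desired one.\<close>
    have "reach (window N x i) (window N x (i - int l))" if "i - int l \<ge> j" for l
      using that
    proof (induction l rule: less_induct)
      case (less l)
      have eq: "window N z (i - int l + int n) = window N x (i - int l)"
        using w[OF z(2), of "i - int l"] less.prems by (simp add: window_translate)
      show ?case
      proof (cases "n \<le> l")
        case True
        then have "window N x (i - int (l - n)) = window N z (i - int l + int n)"
          using w[OF z(1), of "i - int (l - n)"] less.prems by (simp add: algebra_simps of_nat_diff)
        then show ?thesis using less.IH[of "l - n"] True n less.prems eq by simp
      next
        case False
        then have "reach (window N z i) (window N z (i - int l + int n))"
          by (intro reachI[OF zX]) simp
        then show ?thesis using eq w[OF z(1), of i] \<open>\<not> i \<le> j\<close> by simp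
      qed
    qed
    from this[of "nat (i - j)"] False show ?thesis by simp
  qed
next
  assume x: "x \<in> X \<and> (\<forall>i j. reach (window N x i) (window N x j))"
  show "x \<in> NW A X"
    unfolding NW_iff
  proof (intro conjI allI impI)
    fix V assume V: "openin (subshift_top A X) V \<and> x \<in> V"
    then obtain m where m: "0 \<le> m"
      "\<And>y. y \<in> X \<Longrightarrow> y \<in> topspace (full_shift A) \<Longrightarrow> (\<And>i. \<bar>i\<bar> \<le> m \<Longrightarrow> y i = x i) \<Longrightarrow> y \<in> V"
      using openin_subshift_cylinder[of A X V x] by blast
    obtain p n where p: "p \<in> X" "n \<ge> 1" "translate (int n) p = p" "\<And>i. \<bar>i\<bar> \<le> m \<Longrightarrow> p i = x i"
      using periodic_approximation[of x m] x m(1) by blast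
    then have "p \<in> V" using m(2) mem_topspace by blast
    moreover have "translate (int n) p \<in> V" using \<open>p \<in> V\<close> p(3) by simp
    ultimately show "\<exists>n\<ge>1. \<exists>z\<in>V. translate (int n) z \<in> V" using p(2) by blast
  qed (use x in simp)
qed

lemma periodic_mem_NW:
  assumes "p \<in> X" "n \<ge> 1" "translate (int n) p = p"
  shows "p \<in> NW A X"
  unfolding NW_iff
proof (intro conjI allI impI)
  fix V assume "openin (subshift_top A X) V \<and> p \<in> V"
  then have "p \<in> V" "translate (int n) p \<in> V" using assms(3) by auto
  then show "\<exists>n\<ge>1. \<exists>z\<in>V. translate (int n) z \<in> V" using assms(2) by blast
qed (fact assms(1))

text \<open>The communicating class of the word of \<open>x\<close> at position 0, as a set of
  points. All words of a non-wandering \<open>x\<close> communicate, so for such \<open>x\<close>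
  any other position gives the same set.\<close>

definition class_of :: "(int \<Rightarrow> 'a) \<Rightarrow> (int \<Rightarrow> 'a) set" where
  "class_of x = {y \<in> X. \<forall>i. reach (window N x 0) (window N y i) \<and> reach (window N y i) (window N x 0)}"

lemma mem_class_of_self: "x \<in> NW A X \<Longrightarrow> x \<in> class_of x"
  by (simp add: class_of_def mem_NW_iff)

lemma subshift_class_of: "subshift A (class_of x)"
proof (rule subshiftI)
  have "class_of x = {y \<in> topspace (full_shift A). \<forall>i. window N y i \<in> S \<and>
      reach (window N x 0) (window N y i) \<and> reach (window N y i) (window N x 0)}"
    by (auto simp: class_of_def mem_shift_iff topspace_full_shift)
  then show "closedin (full_shift A) (class_of x)"
    using closedin_full_shift_windows[of A "\<lambda>w. w \<in> S \<and> reach (window N x 0) w \<and> reach w (window N x 0)"]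
    by simp
  show "translate m y \<in> class_of x" if "y \<in> class_of x" for y m
    using that subshift_translate[OF subshift_X] by (simp add: class_of_def window_translate)
qed

lemma class_of_subset_NW: "class_of x \<subseteq> NW A X"
proof
  fix y assume "y \<in> class_of x"
  then have "y \<in> X" and r: "\<And>i. reach (window N x 0) (window N y i)"
      "\<And>i. reach (window N y i) (window N x 0)"
    by (auto simp: class_of_def)
  then show "y \<in> NW A X" using reach_trans[OF r(2) r(1)] by (simp add: mem_NW_iff)
qed

text \<open>Two gluings produce a point with the past and centre of \<open>w\<close>, a connecting
  path, and the centre and future of \<open>u\<close>. Since it comes from the class and ends in it,
  every word in between communicates with the class.\<close>

lemma irreducible_class_of:
  assumes "x \<in> NW A X"
  shows "irreducible_subshift A (class_of x)"
  unfolding irreducible_subshift_def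
proof (intro conjI allI impI subshift_class_of)
  show "class_of x \<noteq> {}" using assms mem_class_of_self by blast
  fix U W
  assume H: "openin (subshift_top A (class_of x)) U \<and> openin (subshift_top A (class_of x)) W \<and>
    U \<noteq> {} \<and> W \<noteq> {}"
  then obtain u w where uw: "u \<in> U" "w \<in> W" by blast
  then have uwC: "u \<in> class_of x" "w \<in> class_of x" using H openin_imp_subset by blast+
  then have uwX: "u \<in> X" "w \<in> X" by (auto simp: class_of_def)
  obtain m1 where m1: "0 \<le> m1" "\<And>y. y \<in> class_of x \<Longrightarrow> y \<in> topspace (full_shift A) \<Longrightarrow>
      (\<And>i. \<bar>i\<bar> \<le> m1 \<Longrightarrow> y i = u i) \<Longrightarrow> y \<in> U"
    using H uw openin_subshift_cylinder[of A "class_of x" U u] by blast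
  obtain m2 where m2: "0 \<le> m2" "\<And>y. y \<in> class_of x \<Longrightarrow> y \<in> topspace (full_shift A) \<Longrightarrow>
      (\<And>i. \<bar>i\<bar> \<le> m2 \<Longrightarrow> y i = w i) \<Longrightarrow> y \<in> W"
    using H uw openin_subshift_cylinder[of A "class_of x" W w] by blast
  define m where "m = max m1 m2"
  have m: "0 \<le> m" "m1 \<le> m" "m2 \<le> m" using m1(1) by (auto simp: m_def)
  have "reach (window N w m) (window N u (- m - 1))"
    using uwC unfolding class_of_def by (blast intro: reach_trans)
  then obtain y a b where y: "y \<in> X" "a \<le> b" "window N y a = window N w m"
      "window N y b = window N u (- m - 1)"
    unfolding reach_def by blast
  obtain z where z: "z \<in> X" "\<And>k. k \<le> m + int N \<Longrightarrow> z k = w k"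
    and zl: "\<And>k. k \<le> m \<Longrightarrow> window N z k = window N w k"
    and zr: "\<And>k. m \<le> k \<Longrightarrow> window N z k = window N y (k - m + a)"
    using glue[OF uwX(2) y(1) y(3)[symmetric]] by metis
  define c where "c = m + (b - a)"
  have "window N z c = window N u (- m - 1)"
    using zr[of c] y by (simp add: c_def)
  then obtain v where v: "v \<in> X" "\<And>k. k \<le> c + int N \<Longrightarrow> v k = z k"
      "\<And>k. c < k \<Longrightarrow> v k = u (k - c + (- m - 1))"
    and vl: "\<And>k. k \<le> c \<Longrightarrow> window N v k = window N z k"
    and vr: "\<And>k. c \<le> k \<Longrightarrow> window N v k = window N u (k - c + (- m - 1))"
    using glue[OF z(1) uwX(1)] by metis
  have vC: "v \<in> class_of x"
    unfolding class_of_def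
  proof (intro CollectI conjI allI v(1))
    fix i
    \<comment> \<open>\<open>l\<close> is a position not after \<open>i\<close> where
      \<open>v\<close> still shows a word of \<open>w\<close>; \<open>h\<close> below is one not
      before \<open>i\<close> where \<open>v\<close> shows a word of \<open>u\<close>.\<close>
    define l where "l = min i m"
    have "window N v l = window N w l"
      using vl[of l] zl[of l] y(2) by (simp add: l_def c_def)
    moreover have "reach (window N v l) (window N v i)"
      using v(1) by (intro reachI) (auto simp: l_def)
    ultimately show "reach (window N x 0) (window N v i)"
      using uwC(2) reach_trans unfolding class_of_def by fastforce
    define h where "h = max i c"
    have "window N v h = window N u (h - c + (- m - 1))"
      by (rule vr) (simp add: h_def)
    moreover have "reach (window N v i) (window N v h)"
      using v(1) by (intro reachI) (auto simp: h_def)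
    ultimately show "reach (window N v i) (window N x 0)"
      using uwC(1) reach_trans unfolding class_of_def by fastforce
  qed
  \<comment> \<open>To the right of \<open>c\<close> the point \<open>v\<close> is \<open>u\<close>
    displaced by \<open>c + m + 1\<close>, so this many shifts bring the centre of \<open>u\<close>
    to the origin.\<close>
  define n where "n = nat (c + m + 1)"
  have n: "int n = c + m + 1" "n \<ge> 1" using m(1) y(2) by (auto simp: n_def c_def)
  have "v \<in> W"
    using vC v(1) mem_topspace m v(2) z(2) y(2) by (intro m2(2)) (auto simp: c_def)
  moreover have "translate (int n) v \<in> U"
  proof (rule m1(2))
    show tC: "translate (int n) v \<in> class_of x"
      using subshift_translate[OF subshift_class_of vC] .
    then show "translate (int n) v \<in> topspace (full_shift A)"
      by (simp add: class_of_def mem_topspace)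
    show "translate (int n) v i = u i" if "\<bar>i\<bar> \<le> m1" for i
      using v(3)[of "i + int n"] that m n(1) by (simp add: translate_def)
  qed
  ultimately show "\<exists>n\<ge>1. U \<inter> (shift_map ^^ n) ` W \<noteq> {}"
    using n(2) by (auto simp: funpow_shift_map)
qed

lemma class_of_eq:
  assumes "x \<in> NW A X" "y \<in> class_of x"
  shows "class_of y = class_of x"
proof -
  have "reach (window N x 0) (window N y 0)" "reach (window N y 0) (window N x 0)"
    using assms by (simp_all add: class_of_def)
  then have "reach (window N y 0) v \<longleftrightarrow> reach (window N x 0) v"
      "reach v (window N y 0) \<longleftrightarrow> reach v (window N x 0)" for v
    by (meson reach_trans)+
  then show ?thesis unfolding class_of_def by simp
qed

text \<open>A class depends on \<open>x\<close> only through one word of length \<open>N\<close>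
  over a finite alphabet.\<close>

lemma finite_classes: "finite (class_of ` NW A X)"
proof -
  define f where "f v = {y \<in> X. \<forall>i. reach v (window N y i) \<and> reach (window N y i) v}" for v
  have "class_of ` NW A X \<subseteq> f ` {w. set w \<subseteq> A \<and> length w = N}"
  proof
    fix C assume "C \<in> class_of ` NW A X"
    then obtain x where x: "x \<in> X" "C = class_of x" by (auto simp: mem_NW_iff)
    then have "window N x 0 \<in> {w. set w \<subseteq> A \<and> length w = N}"
      by (auto simp: window_def mem_shift_iff simp del: upt_Suc)
    moreover have "C = f (window N x 0)" by (simp add: x(2) f_def class_of_def)
    ultimately show "C \<in> f ` {w. set w \<subseteq> A \<and> length w = N}" by blast
  qed
  then show ?thesis
    by (rule finite_subset) (simp add: finite_lists_length_eq finite_alphabet)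
qed

lemma partition_classes: "partition_on (NW A X) (class_of ` NW A X)"
proof (rule partition_onI)
  show "\<Union> (class_of ` NW A X) = NW A X"
    using class_of_subset_NW mem_class_of_self by blast
  show "disjnt C D" if "C \<in> class_of ` NW A X" "D \<in> class_of ` NW A X" "C \<noteq> D" for C D
  proof -
    from that obtain x y where xy: "x \<in> NW A X" "y \<in> NW A X" "C = class_of x" "D = class_of y"
      by blast
    have False if "z \<in> C" "z \<in> D" for z
      using class_of_eq[OF xy(1), of z] class_of_eq[OF xy(2), of z] that xy(3,4) \<open>C \<noteq> D\<close> by simp
    then show ?thesis by (auto simp: disjnt_def)
  qed
  show "{} \<notin> class_of ` NW A X"
    using mem_class_of_self by blast
qed

end

section \<open>Irreducible components and limit sets\<close>

text \<open>The preimages of the parts are closed and finite in number, hence open, and they are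
  shift-invariant, so topological transitivity permits only one of them to be non-empty.\<close>

lemma irreducible_image_unique_part:
  assumes irr: "irreducible_subshift A Y" and "finite P"
    and sub: "\<And>D. D \<in> P \<Longrightarrow> subshift A D" and disj: "disjoint P"
    and cont: "continuous_map (subshift_top A Y) (full_shift A) f"
    and comm: "\<And>y. y \<in> Y \<Longrightarrow> f (shift_map y) = shift_map (f y)"
    and img: "f ` Y \<subseteq> \<Union>P"
  shows "\<exists>!D. D \<in> P \<and> f ` Y \<subseteq> D"
proof -
  have Y: "subshift A Y" "Y \<noteq> {}" using irr by (auto simp: irreducible_subshift_def)
  note top = topspace_subshift_top[OF Y(1)]
  have closed: "closedin (subshift_top A Y) {y \<in> Y. f y \<in> E}" if "E \<in> P" for E
    using closedin_continuous_map_preimage[OF cont, of E] sub[OF that]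
    unfolding top subshift_def by simp
  have opn: "openin (subshift_top A Y) {y \<in> Y. f y \<in> E}" if "E \<in> P" for E
  proof -
    have "closedin (subshift_top A Y) (\<Union>D\<in>P - {E}. {y \<in> Y. f y \<in> D})"
      using \<open>finite P\<close> closed by (intro closedin_Union) auto
    moreover have "{y \<in> Y. f y \<in> E} = Y - (\<Union>D\<in>P - {E}. {y \<in> Y. f y \<in> D})"
    proof (intro equalityI subsetI)
      fix y assume "y \<in> {y \<in> Y. f y \<in> E}"
      then show "y \<in> Y - (\<Union>D\<in>P - {E}. {y \<in> Y. f y \<in> D})"
        using disjointD[OF disj that] by auto
    next
      fix y assume y: "y \<in> Y - (\<Union>D\<in>P - {E}. {y \<in> Y. f y \<in> D})"
      then obtain D where "D \<in> P" "f y \<in> D" using img by blast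
      with y show "y \<in> {y \<in> Y. f y \<in> E}" by auto
    qed
    ultimately show ?thesis by (simp only: closedin_def top)
  qed
  have pow: "f (translate (int n) y) = translate (int n) (f y)" if "y \<in> Y" for n y
  proof (induction n)
    case (Suc n)
    have "f (translate (int (Suc n)) y) = f (shift_map (translate (int n) y))"
      by (simp add: shift_map_eq_translate translate_translate add.commute)
    also have "\<dots> = shift_map (translate (int n) (f y))"
      using comm subshift_translate[OF Y(1) that] Suc by simp
    also have "\<dots> = translate (int (Suc n)) (f y)"
      by (simp add: shift_map_eq_translate translate_translate add.commute)
    finally show ?case .
  qed simp
  have same: "D = E" if DE: "D \<in> P" "E \<in> P" and "u \<in> Y" "f u \<in> D" "v \<in> Y" "f v \<in> E" for D E u v
  proof -
    have "{y \<in> Y. f y \<in> D} \<noteq> {}" "{y \<in> Y. f y \<in> E} \<noteq> {}" using that by auto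
    then obtain n where "{y \<in> Y. f y \<in> D} \<inter> (shift_map ^^ n) ` {y \<in> Y. f y \<in> E} \<noteq> {}"
      using irr opn[OF DE(1)] opn[OF DE(2)] unfolding irreducible_subshift_def by meson
    then obtain w where w: "w \<in> Y" "f w \<in> E" "f (translate (int n) w) \<in> D"
      by (auto simp: funpow_shift_map)
    then have "translate (int n) (f w) \<in> D \<inter> E"
      using pow subshift_translate[OF sub[OF that(2)]] by simp
    then show ?thesis using disjointD[OF disj that(1,2)] by blast
  qed
  obtain y where y: "y \<in> Y" using Y(2) by blast
  then obtain D where D: "D \<in> P" "f y \<in> D" using img by blast
  show ?thesis
  proof (rule ex1I[of _ D])
    have "f v \<in> D" if v: "v \<in> Y" for v
    proof -
      obtain E where "E \<in> P" "f v \<in> E" using img v by blast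
      then show ?thesis using same[OF D(1) _ y D(2) v] by blast
    qed
    then show "D \<in> P \<and> f ` Y \<subseteq> D" using D(1) by blast
    show "E = D" if "E \<in> P \<and> f ` Y \<subseteq> E" for E
      using same[OF _ D(1) y _ y D(2)] that y by blast
  qed
qed

text \<open>A part of \<open>P\<close> sits in a part of \<open>Q\<close>, which sits in a part of
  \<open>P\<close>; disjointness collapses the chain to equalities. Used in both directions, this
  gives the uniqueness behind \<open>irreducible_components\<close>.\<close>

lemma irreducible_partition_subset:
  assumes P: "partition_on Z P" "\<forall>C\<in>P. irreducible_subshift A C" "finite P"
    and Q: "partition_on Z Q" "\<forall>C\<in>Q. irreducible_subshift A C" "finite Q"
  shows "P \<subseteq> Q"
proof
  have step: "\<exists>D\<in>R'. C \<subseteq> D" if "C \<in> R" and R: "partition_on Z R" "\<forall>C\<in>R. irreducible_subshift A C"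
    and R': "partition_on Z R'" "\<forall>C\<in>R'. irreducible_subshift A C" "finite R'" for R R' C
  proof -
    \<comment> \<open>The inclusion of \<open>C\<close> is viewed as a shift-commuting map into the
      other partition.\<close>
    have "\<exists>!D. D \<in> R' \<and> (\<lambda>x. x) ` C \<subseteq> D"
    proof (rule irreducible_image_unique_part[OF _ R'(3)])
      show "irreducible_subshift A C" using that by blast
      show "subshift A D" if "D \<in> R'" for D using that R'(2) by (simp add: irreducible_subshift_def)
      show "disjoint R'" using R'(1) by (rule partition_onD2)
      show "(\<lambda>x. x) ` C \<subseteq> \<Union>R'"
        using that(1) partition_onD1[OF R(1)] partition_onD1[OF R'(1)] by auto
    qed (auto intro: continuous_map_from_subtopology)
    then show ?thesis by auto
  qed
  fix C assume C: "C \<in> P"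
  then obtain D where D: "D \<in> Q" "C \<subseteq> D" using step P(1,2) Q by metis
  then obtain C' where C': "C' \<in> P" "D \<subseteq> C'" using step Q(1,2) P by metis
  have "C \<noteq> {}" using C P(2) by (auto simp: irreducible_subshift_def)
  then have "C = C'" using disjointD[OF partition_onD2[OF P(1)] C C'(1)] D(2) C'(2) by blast
  then show "C \<in> Q" using D C' by simp
qed

text \<open>The sign \<open>s\<close> covers both time directions, so that facts about
  \<open>alpha_limit\<close> and \<open>omega_limit\<close> are proved together.\<close>

definition limit_set :: "'a set \<Rightarrow> int \<Rightarrow> (int \<Rightarrow> 'a) \<Rightarrow> (int \<Rightarrow> 'a) set" where
  "limit_set A s x = {y. \<exists>n::nat \<Rightarrow> nat. strict_mono n \<and>
     limitin (full_shift A) (\<lambda>k. translate (s * int (n k)) x) y sequentially}"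

lemma alpha_limit_eq: "alpha_limit A x = limit_set A (-1) x"
  by (simp add: alpha_limit_def limit_set_def funpow_inv_shift_map)

lemma omega_limit_eq: "omega_limit A x = limit_set A 1 x"
  by (simp add: omega_limit_def limit_set_def funpow_shift_map)

text \<open>Limit sets are defined by sequences, so compactness is turned into sequential
  compactness through a metric; the convergent subsequence provides the strictly increasing
  times.\<close>

lemma limit_set_nonempty:
  assumes "finite A" "x \<in> topspace (full_shift A)"
  shows "limit_set A s x \<noteq> {}"
proof -
  obtain M d where M: "Metric_space M d" "full_shift A = Metric_space.mtopology M d"
    using metrizable_space_full_shift unfolding metrizable_space_def by blast
  have "range (\<lambda>k. translate (s * int k) x) \<subseteq> topspace (full_shift A)"
    using assms(2) by (auto simp: topspace_full_shift translate_def)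
  moreover have "compactin (full_shift A) (topspace (full_shift A))"
    using compact_space_full_shift[OF assms(1)] by (simp add: compact_space_def)
  ultimately obtain l r where "strict_mono (r :: nat \<Rightarrow> nat)"
      "limitin (full_shift A) ((\<lambda>k. translate (s * int k) x) \<circ> r) l sequentially"
    using Metric_space.compactin_sequentially[OF M(1)] unfolding M(2) by meson
  then show ?thesis by (auto simp: limit_set_def o_def)
qed

section \<open>Components as communicating classes, and the location of limit sets\<close>

context finite_type_shift
begin

lemma irreducible_components_eq: "irreducible_components A X = class_of ` NW A X"
  unfolding irreducible_components_def
proof (rule the_equality)
  show ok: "finite (class_of ` NW A X) \<and> partition_on (NW A X) (class_of ` NW A X) \<and>
      (\<forall>C\<in>class_of ` NW A X. irreducible_subshift A C)"
    using finite_classes partition_classes irreducible_class_of by blast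
  show "P = class_of ` NW A X"
    if "finite P \<and> partition_on (NW A X) P \<and> (\<forall>C\<in>P. irreducible_subshift A C)" for P
    using ok that by (intro equalityI irreducible_partition_subset[where Z = "NW A X"]) auto
qed

lemma component_subshift: "C \<in> irreducible_components A X \<Longrightarrow> subshift A C"
  unfolding irreducible_components_eq using subshift_class_of by blast

lemma disjoint_components: "disjoint (irreducible_components A X)"
  unfolding irreducible_components_eq using partition_classes by (rule partition_onD2)

lemma Union_components: "\<Union> (irreducible_components A X) = NW A X"
  unfolding irreducible_components_eq using partition_onD1[OF partition_classes] by simp

lemma component_eqI:
  "C \<in> irreducible_components A X \<Longrightarrow> D \<in> irreducible_components A X \<Longrightarrow> x \<in> C \<Longrightarrow> x \<in> D \<Longrightarrow> C = D"
  by (metis IntI disjointD disjoint_components empty_iff)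

lemma component_nonempty: "C \<in> irreducible_components A X \<Longrightarrow> C \<noteq> {}"
  unfolding irreducible_components_eq using partition_onD3[OF partition_classes] by blast

lemma subshift_NW: "subshift A (NW A X)"
proof (rule subshiftI)
  show "closedin (full_shift A) (NW A X)"
    unfolding Union_components[symmetric]
    using finite_classes component_subshift unfolding irreducible_components_eq
    by (intro closedin_Union) (auto simp: subshift_def)
  show "translate m x \<in> NW A X" if "x \<in> NW A X" for x m
  proof -
    from that obtain C where C: "C \<in> irreducible_components A X" "x \<in> C"
      unfolding Union_components[symmetric] by blast
    then have "translate m x \<in> C" by (intro subshift_translate[OF component_subshift])
    then show ?thesis using C(1) unfolding Union_components[symmetric] by blast
  qed
qed

text \<open>Convergence fixes any finite set of coordinates from some index on, so a word of a limit
  point recurs along the orbit at arbitrarily late times. The free bound \<open>M\<close> allows two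
  occurrences to be put in a prescribed order.\<close>

lemma limit_set_window:
  assumes "x \<in> X" "y \<in> limit_set A s x"
  shows "\<exists>n\<ge>M. window N y i = window N x (i + s * int n)"
proof -
  obtain n where n: "strict_mono (n :: nat \<Rightarrow> nat)"
      and lim: "limitin (full_shift A) (\<lambda>k. translate (s * int (n k)) x) y sequentially"
    using assms(2) by (auto simp: limit_set_def)
  have "openin (full_shift A) {z \<in> topspace (full_shift A). window N z i = window N y i}"
    by (rule openin_full_shift_local[of "{i..i + int N}"]) (simp, metis window_local)
  moreover have "y \<in> {z \<in> topspace (full_shift A). window N z i = window N y i}"
    using lim limitin_topspace by fastforce
  ultimately have "\<forall>\<^sub>F k in sequentially. translate (s * int (n k)) x \<in>
      {z \<in> topspace (full_shift A). window N z i = window N y i}"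
    using lim unfolding limitin_def by blast
  then obtain K where K: "\<And>k. k \<ge> K \<Longrightarrow> window N (translate (s * int (n k)) x) i = window N y i"
    unfolding eventually_sequentially by blast
  have "n (max K M) \<ge> M" using seq_suble[OF n, of "max K M"] by simp
  moreover have "window N y i = window N x (i + s * int (n (max K M)))"
    using K[of "max K M"] by (simp add: window_translate)
  ultimately show ?thesis by blast
qed

lemma limit_set_reach:
  assumes x: "x \<in> X" and s: "s = 1 \<or> s = -1" and "y \<in> limit_set A s x" "y' \<in> limit_set A s x"
  shows "reach (window N y i) (window N y' j)"
proof (cases "s = 1")
  case True
  obtain n where n: "window N y i = window N x (i + int n)"
    using limit_set_window[OF x assms(3), of 0 i] True by auto
  obtain n' where n': "n' \<ge> nat (i + int n - j)" "window N y' j = window N x (j + int n')"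
    using limit_set_window[OF x assms(4), of "nat (i + int n - j)" j] True by auto
  show ?thesis unfolding n n'(2) using n'(1) by (intro reachI[OF x]) linarith
next
  case False
  with s have s: "s = -1" by simp
  \<comment> \<open>In backward time the target word is located first, and then the source word far
    enough to the left of it.\<close>
  obtain n' where n': "window N y' j = window N x (j - int n')"
    using limit_set_window[OF x assms(4), of 0 j] s by auto
  obtain n where n: "n \<ge> nat (i - j + int n')" "window N y i = window N x (i - int n)"
    using limit_set_window[OF x assms(3), of "nat (i - j + int n')" i] s by auto
  show ?thesis unfolding n' n(2) using n(1) by (intro reachI[OF x]) linarith
qed

lemma limit_set_subset:
  assumes x: "x \<in> X"
  shows "limit_set A s x \<subseteq> X"
proof
  fix y assume y: "y \<in> limit_set A s x"
  then have "y \<in> topspace (full_shift A)"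
    by (auto simp: limit_set_def dest: limitin_topspace)
  moreover have "window N y i \<in> S" for i
    using limit_set_window[OF x y, of 0 i] x by (auto simp: mem_shift_iff)
  ultimately show "y \<in> X" by (simp add: shift_eq)
qed

text \<open>Words of limit points all reach one another. Hence limit points are non-wandering, and
  they share one communicating class.\<close>

lemma limit_set_component:
  assumes x: "x \<in> X" and s: "s = 1 \<or> s = -1"
  shows "\<exists>!C. C \<in> irreducible_components A X \<and> limit_set A s x \<subseteq> C"
proof -
  obtain y where y: "y \<in> limit_set A s x"
    using limit_set_nonempty[OF finite_alphabet mem_topspace[OF x]] by blast
  have "y \<in> NW A X"
    using y limit_set_subset[OF x] limit_set_reach[OF x s y y] by (auto simp: mem_NW_iff)
  then have "class_of y \<in> irreducible_components A X" by (simp add: irreducible_components_eq)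
  moreover have "limit_set A s x \<subseteq> class_of y"
    using limit_set_subset[OF x] limit_set_reach[OF x s] y by (auto simp: class_of_def)
  ultimately show ?thesis using component_eqI[of _ "class_of y" y] y by blast
qed

lemma alpha_component:
  assumes "x \<in> X"
  shows "alpha_component A X x \<in> irreducible_components A X"
    "limit_set A (-1) x \<subseteq> alpha_component A X x"
  using theI'[OF limit_set_component[OF assms, of "-1"]]
  by (simp_all add: alpha_component_def alpha_limit_eq)

lemma omega_component:
  assumes "x \<in> X"
  shows "omega_component A X x \<in> irreducible_components A X"
    "limit_set A 1 x \<subseteq> omega_component A X x"
  using theI'[OF limit_set_component[OF assms, of 1]]
  by (simp_all add: omega_component_def omega_limit_eq)

lemma finite_periodic:
  assumes "n \<ge> 1"
  shows "finite {x \<in> X. translate (int n) x = x}"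
proof (rule finite_subset)
  show "{x \<in> X. translate (int n) x = x}
      \<subseteq> (\<lambda>f i. f (i mod int n)) ` (\<Pi>\<^sub>E i\<in>{0..<int n}. A)"
  proof
    fix x assume "x \<in> {x \<in> X. translate (int n) x = x}"
    then have x: "x \<in> X" "\<And>i. x (i + int n) = x i"
      by (auto simp: translate_def fun_eq_iff)
    have per: "x (i + int k * int n) = x i" for i k
    proof (induction k)
      case (Suc k)
      then show ?case using x(2)[of "i + int k * int n"] by (simp add: algebra_simps)
    qed simp
    have mult: "x (i + q * int n) = x i" for i q
    proof (cases "0 \<le> q")
      case True then show ?thesis using per[of i "nat q"] by simp
    next
      case False then show ?thesis using per[of "i + q * int n" "nat (- q)"] by simp
    qed
    have "x i = restrict x {0..<int n} (i mod int n)" for i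
      using mult[of "i mod int n" "i div int n"] assms by simp
    moreover have "restrict x {0..<int n} \<in> (\<Pi>\<^sub>E i\<in>{0..<int n}. A)"
      using x(1) by (auto simp: mem_shift_iff)
    ultimately show "x \<in> (\<lambda>f i. f (i mod int n)) ` (\<Pi>\<^sub>E i\<in>{0..<int n}. A)" by blast
  qed
  show "finite ((\<lambda>f i. f (i mod int n)) ` (\<Pi>\<^sub>E i\<in>{0..<int n}. A))"
    using finite_alphabet by (intro finite_imageI finite_PiE) auto
qed

end

section \<open>Injective endomorphisms\<close>

locale injective_endomorphism = finite_type_shift +
  fixes \<tau> :: "(int \<Rightarrow> 'a) \<Rightarrow> (int \<Rightarrow> 'a)"
  assumes endo: "subshift_endomorphism A X \<tau>" and inj: "inj_on \<tau> X"
begin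

lemma continuous: "continuous_map (subshift_top A X) (subshift_top A X) \<tau>"
  using endo by (simp add: subshift_endomorphism_def)

lemma continuous_on_subset:
  assumes "C \<subseteq> X"
  shows "continuous_map (subshift_top A C) (full_shift A) \<tau>"
proof -
  have "continuous_map (subshift_top A X) (full_shift A) \<tau>"
    using continuous by (simp add: continuous_map_in_subtopology)
  then show ?thesis using assms by (rule continuous_map_from_subtopology_mono)
qed

lemma mem_image: "x \<in> X \<Longrightarrow> \<tau> x \<in> X"
  using continuous_map_image_subset_topspace[OF continuous]
  unfolding topspace_subshift_top[OF subshift_X] by blast

lemma commute_shift: "x \<in> X \<Longrightarrow> \<tau> (shift_map x) = shift_map (\<tau> x)"
  using endo by (simp add: subshift_endomorphism_def)

lemma commute_translate:
  assumes "x \<in> X"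
  shows "\<tau> (translate m x) = translate m (\<tau> x)"
proof -
  have fwd: "\<tau> (translate (int n) y) = translate (int n) (\<tau> y)" if "y \<in> X" for n y
  proof (induction n)
    case (Suc n)
    have "\<tau> (translate (int (Suc n)) y) = \<tau> (shift_map (translate (int n) y))"
      by (simp add: shift_map_eq_translate translate_translate add.commute)
    also have "\<dots> = shift_map (translate (int n) (\<tau> y))"
      using commute_shift subshift_translate[OF subshift_X that] Suc by simp
    also have "\<dots> = translate (int (Suc n)) (\<tau> y)"
      by (simp add: shift_map_eq_translate translate_translate add.commute)
    finally show ?case .
  qed simp
  show ?thesis
  proof (cases "0 \<le> m")
    case True
    then show ?thesis using fwd[OF assms, of "nat m"] by simp
  next
    case False
    have "\<tau> x = translate (- m) (\<tau> (translate m x))"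
      using fwd[OF subshift_translate[OF subshift_X assms, of m], of "nat (- m)"] False
      by (simp add: translate_translate)
    then have "translate m (\<tau> x) = translate m (translate (- m) (\<tau> (translate m x)))" by simp
    then show ?thesis by (simp add: translate_translate)
  qed
qed

text \<open>A neighborhood of \<open>\<tau> x\<close> pulls back to one of \<open>x\<close>, and
  \<open>\<tau>\<close> carries a return in the latter to a return in the former.\<close>

lemma image_NW_subset: "\<tau> ` NW A X \<subseteq> NW A X"
proof
  fix y assume "y \<in> \<tau> ` NW A X"
  then obtain x where x: "x \<in> NW A X" "y = \<tau> x" by blast
  then have xX: "x \<in> X" by (simp add: NW_iff)
  show "y \<in> NW A X"
    unfolding NW_iff
  proof (intro conjI allI impI)
    show "y \<in> X" using xX x(2) mem_image by simp
    fix V assume V: "openin (subshift_top A X) V \<and> y \<in> V"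
    then have "openin (subshift_top A X) {z \<in> X. \<tau> z \<in> V}"
      using openin_continuous_map_preimage[OF continuous, of V]
      unfolding topspace_subshift_top[OF subshift_X] by blast
    moreover have "x \<in> {z \<in> X. \<tau> z \<in> V}" using V x(2) xX by simp
    ultimately obtain n z where "n \<ge> 1" "z \<in> {z \<in> X. \<tau> z \<in> V}"
        "translate (int n) z \<in> {z \<in> X. \<tau> z \<in> V}"
      using x(1) unfolding NW_iff by blast
    then show "\<exists>n\<ge>1. \<exists>z\<in>V. translate (int n) z \<in> V"
      using commute_translate by auto
  qed
qed

lemma image_periodic:
  assumes "n \<ge> 1"
  shows "\<tau> ` {x \<in> X. translate (int n) x = x} = {x \<in> X. translate (int n) x = x}"
proof (rule endo_inj_surj[OF finite_periodic[OF assms]])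
  show "\<tau> ` {x \<in> X. translate (int n) x = x} \<subseteq> {x \<in> X. translate (int n) x = x}"
    using mem_image commute_translate[symmetric] by auto
  show "inj_on \<tau> {x \<in> X. translate (int n) x = x}"
    using inj by (rule inj_on_subset) auto
qed

lemma closedin_image_NW: "closedin (full_shift A) (\<tau> ` NW A X)"
proof (rule compactin_imp_closedin[OF Hausdorff_space_full_shift])
  have "compactin (full_shift A) (NW A X)"
    using subshift_NW compact_space_full_shift[OF finite_alphabet]
    by (simp add: subshift_def closedin_compact_space)
  moreover have "NW A X \<subseteq> X" by (auto simp: NW_iff)
  ultimately have "compactin (subshift_top A X) (NW A X)"
    by (simp add: compactin_subtopology)
  then have "compactin (subshift_top A X) (\<tau> ` NW A X)"
    using continuous image_compactin by blast
  then show "compactin (full_shift A) (\<tau> ` NW A X)"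
    by (simp add: compactin_subtopology)
qed

lemma image_NW: "\<tau> ` NW A X = NW A X"
proof (intro equalityI image_NW_subset subsetI, rule ccontr)
  fix x assume x: "x \<in> NW A X" "x \<notin> \<tau> ` NW A X"
  then have xX: "x \<in> X" by (simp add: NW_iff)
  have "openin (full_shift A) (topspace (full_shift A) - \<tau> ` NW A X)"
    using closedin_image_NW by blast
  then obtain m where m: "0 \<le> m" "\<And>y. y \<in> topspace (full_shift A) \<Longrightarrow>
      (\<And>i. \<bar>i\<bar> \<le> m \<Longrightarrow> y i = x i) \<Longrightarrow> y \<in> topspace (full_shift A) - \<tau> ` NW A X"
    using openin_full_shift_cylinder[of A _ x] x(2) mem_topspace[OF xX] by blast
  \<comment> \<open>The cylinder around \<open>x\<close> that misses the image contains a periodic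
    point; yet that point is in the image, since \<open>\<tau>\<close> permutes the points of its
    period.\<close>
  obtain p n where p: "p \<in> X" "n \<ge> 1" "translate (int n) p = p" "\<And>i. \<bar>i\<bar> \<le> m \<Longrightarrow> p i = x i"
    using periodic_approximation[of x m] x(1)[unfolded mem_NW_iff] m(1) by blast
  have "p \<in> \<tau> ` {x \<in> X. translate (int n) x = x}"
    using image_periodic[OF p(2)] p(1,3) by simp
  moreover have "{x \<in> X. translate (int n) x = x} \<subseteq> NW A X"
    using periodic_mem_NW[OF _ p(2)] by blast
  ultimately have "p \<in> \<tau> ` NW A X" by blast
  then show False using m(2)[OF mem_topspace[OF p(1)] p(4)] by blast
qed

text \<open>Continuity of the inverse is automatic for a continuous bijection from a compact space
  onto a Hausdorff space.\<close>

lemma topological_conjugacy_image: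
  assumes "subshift A C" "subshift A D" "C \<subseteq> X" "\<tau> ` C = D"
  shows "topological_conjugacy A C D \<tau>"
  unfolding topological_conjugacy_def
proof (intro conjI assms(1,2) ballI)
  show "\<tau> (shift_map x) = shift_map (\<tau> x)" if "x \<in> C" for x
    using that assms(3) commute_shift by blast
  show "homeomorphic_map (subshift_top A C) (subshift_top A D) \<tau>"
  proof (rule continuous_imp_homeomorphic_map)
    show "compact_space (subshift_top A C)"
      by (rule compact_space_subshift[OF finite_alphabet assms(1)])
    show "Hausdorff_space (subshift_top A D)"
      by (rule Hausdorff_space_subtopology[OF Hausdorff_space_full_shift])
    show "continuous_map (subshift_top A C) (subshift_top A D) \<tau>"
      using continuous_on_subset[OF assms(3)] assms(4)
      by (auto simp: continuous_map_in_subtopology)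
    show "\<tau> ` topspace (subshift_top A C) = topspace (subshift_top A D)"
      unfolding topspace_subshift_top[OF assms(1)] topspace_subshift_top[OF assms(2)]
      by (rule assms(4))
    show "inj_on \<tau> (topspace (subshift_top A C))"
      unfolding topspace_subshift_top[OF assms(1)] using inj assms(3) by (rule inj_on_subset)
  qed
qed

section \<open>The induced map on components\<close>

lemma component_subset:
  assumes "C \<in> irreducible_components A X"
  shows "C \<subseteq> NW A X" "C \<subseteq> X"
proof -
  show "C \<subseteq> NW A X" using assms unfolding Union_components[symmetric] by blast
  then show "C \<subseteq> X" by (auto simp: NW_iff)
qed

lemma component_map:
  assumes C: "C \<in> irreducible_components A X"
  shows "component_map A X \<tau> C \<in> irreducible_components A X" "\<tau> ` C \<subseteq> component_map A X \<tau> C"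
proof -
  have "\<exists>!D. D \<in> irreducible_components A X \<and> \<tau> ` C \<subseteq> D"
  proof (rule irreducible_image_unique_part)
    show "irreducible_subshift A C"
      using C irreducible_class_of by (auto simp: irreducible_components_eq)
    show "finite (irreducible_components A X)"
      by (simp add: irreducible_components_eq finite_classes)
    show "continuous_map (subshift_top A C) (full_shift A) \<tau>"
      by (rule continuous_on_subset[OF component_subset(2)[OF C]])
    show "\<tau> ` C \<subseteq> \<Union> (irreducible_components A X)"
      unfolding Union_components using component_subset(1)[OF C] image_NW_subset by blast
  qed (use component_subshift disjoint_components commute_shift component_subset(2)[OF C] in blast)+
  from theI'[OF this] show "component_map A X \<tau> C \<in> irreducible_components A X"
      "\<tau> ` C \<subseteq> component_map A X \<tau> C"
    by (simp_all add: component_map_def)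
qed

text \<open>Components are disjoint, so the image of a single point already identifies the target
  component.\<close>

lemma component_map_eqI:
  assumes "C \<in> irreducible_components A X" "D \<in> irreducible_components A X" "x \<in> C" "\<tau> x \<in> D"
  shows "component_map A X \<tau> C = D"
proof (rule component_eqI)
  show "\<tau> x \<in> component_map A X \<tau> C" using component_map(2)[OF assms(1)] assms(3) by blast
qed (use component_map(1) assms in auto)

lemma bij_component_map:
  "bij_betw (component_map A X \<tau>) (irreducible_components A X) (irreducible_components A X)"
proof -
  have "component_map A X \<tau> ` irreducible_components A X = irreducible_components A X"
  proof (intro equalityI subsetI)
    fix D assume D: "D \<in> irreducible_components A X"
    then obtain y where y: "y \<in> D" using component_nonempty by blast
    then obtain x where x: "x \<in> NW A X" "y = \<tau> x"
      using component_subset(1)[OF D] image_NW by blast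
    then obtain C where C: "C \<in> irreducible_components A X" "x \<in> C"
      using Union_components by blast
    then have "component_map A X \<tau> C = D" using component_map_eqI[OF C(1) D C(2)] y x(2) by simp
    then show "D \<in> component_map A X \<tau> ` irreducible_components A X" using C(1) by blast
  qed (use component_map in blast)
  moreover have "finite (irreducible_components A X)"
    by (simp add: irreducible_components_eq finite_classes)
  ultimately show ?thesis by (simp add: bij_betw_def eq_card_imp_inj_on)
qed

text \<open>A non-wandering preimage of a point of the target lies in some component
  \<open>C'\<close> with the same image as \<open>C\<close> under \<open>component_map\<close>, and
  injectivity of that map forces \<open>C' = C\<close>.\<close>

lemma image_component:
  assumes C: "C \<in> irreducible_components A X"
  shows "\<tau> ` C = component_map A X \<tau> C"
proof (intro equalityI component_map(2)[OF C] subsetI)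
  fix y assume y: "y \<in> component_map A X \<tau> C"
  then obtain x where x: "x \<in> NW A X" "y = \<tau> x"
    using component_subset(1)[OF component_map(1)[OF C]] image_NW by blast
  then obtain C' where C': "C' \<in> irreducible_components A X" "x \<in> C'"
    using Union_components by blast
  have "component_map A X \<tau> C' = component_map A X \<tau> C"
    using component_map_eqI[OF C'(1) component_map(1)[OF C] C'(2)] y x(2) by simp
  then have "C' = C"
    using bij_component_map C C'(1) by (auto simp: bij_betw_def dest: inj_onD)
  then show "y \<in> \<tau> ` C" using C'(2) x(2) by blast
qed

section \<open>Limit sets and the order under \<open>\<tau>\<close>\<close>

lemma image_limit_set:
  assumes x: "x \<in> X" and y: "y \<in> limit_set A s x"
  shows "\<tau> y \<in> limit_set A s (\<tau> x)"
proof -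
  obtain n where n: "strict_mono (n :: nat \<Rightarrow> nat)"
      and lim: "limitin (full_shift A) (\<lambda>k. translate (s * int (n k)) x) y sequentially"
    using y by (auto simp: limit_set_def)
  have "y \<in> X" using y limit_set_subset[OF x] by blast
  \<comment> \<open>\<open>\<tau>\<close> is given as continuous on the subspace \<open>X\<close>,
    so the convergence is moved there, which requires the limit to lie in \<open>X\<close>.\<close>
  with lim have "limitin (subshift_top A X) (\<lambda>k. translate (s * int (n k)) x) y sequentially"
    using subshift_translate[OF subshift_X x] by (simp add: limitin_subtopology)
  then have "limitin (subshift_top A X) (\<tau> \<circ> (\<lambda>k. translate (s * int (n k)) x)) (\<tau> y) sequentially"
    using continuous by (rule continuous_map_limit[rotated])
  then have "limitin (full_shift A) (\<lambda>k. translate (s * int (n k)) (\<tau> x)) (\<tau> y) sequentially"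
    using commute_translate[OF x] by (simp add: limitin_subtopology o_def)
  with n show ?thesis by (auto simp: limit_set_def)
qed

text \<open>One limit point is enough: its image is a limit point of \<open>\<tau> x\<close>, and
  this single pair determines the value of \<open>component_map\<close>.\<close>

lemma alpha_component_image:
  assumes x: "x \<in> X"
  shows "alpha_component A X (\<tau> x) = component_map A X \<tau> (alpha_component A X x)"
proof -
  obtain y where y: "y \<in> limit_set A (-1) x"
    using limit_set_nonempty[OF finite_alphabet mem_topspace[OF x]] by blast
  then have "y \<in> alpha_component A X x" "\<tau> y \<in> alpha_component A X (\<tau> x)"
    using alpha_component(2)[OF x] alpha_component(2)[OF mem_image[OF x]] image_limit_set[OF x]
    by blast+
  then show ?thesis
    using component_map_eqI[OF alpha_component(1)[OF x] alpha_component(1)[OF mem_image[OF x]]]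
    by simp
qed

lemma omega_component_image:
  assumes x: "x \<in> X"
  shows "omega_component A X (\<tau> x) = component_map A X \<tau> (omega_component A X x)"
proof -
  obtain y where y: "y \<in> limit_set A 1 x"
    using limit_set_nonempty[OF finite_alphabet mem_topspace[OF x]] by blast
  then have "y \<in> omega_component A X x" "\<tau> y \<in> omega_component A X (\<tau> x)"
    using omega_component(2)[OF x] omega_component(2)[OF mem_image[OF x]] image_limit_set[OF x]
    by blast+
  then show ?thesis
    using component_map_eqI[OF omega_component(1)[OF x] omega_component(1)[OF mem_image[OF x]]]
    by simp
qed

lemma component_le_image:
  "component_le A X C D \<Longrightarrow> component_le A X (component_map A X \<tau> C) (component_map A X \<tau> D)"
  unfolding component_le_def
proof (elim bexE conjE)
  fix x assume "x \<in> X" "alpha_component A X x = C" "omega_component A X x = D"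
  then show "\<exists>x\<in>X. alpha_component A X x = component_map A X \<tau> C \<and>
      omega_component A X x = component_map A X \<tau> D"
    using alpha_component_image[of x] omega_component_image[of x]
    by (intro bexI[of _ "\<tau> x"]) (simp_all add: mem_image)
qed

lemma poset_automorphism_component_map:
  "poset_automorphism (irreducible_components A X) (component_le A X) (component_map A X \<tau>)"
  unfolding poset_automorphism_def
proof (intro conjI bij_component_map ballI iffI component_le_image)
  let ?K = "irreducible_components A X" and ?\<rho> = "component_map A X \<tau>"
  fix C D assume CD: "C \<in> ?K" "D \<in> ?K" and le: "component_le A X (?\<rho> C) (?\<rho> D)"
  \<comment> \<open>\<open>?\<rho>\<close> acts injectively on the finite set of comparable pairs, hence also surjectively.\<close>
  define R where "R = {(C, D). C \<in> ?K \<and> D \<in> ?K \<and> component_le A X C D}"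
  have inj\<rho>: "inj_on ?\<rho> ?K" using bij_component_map by (rule bij_betw_imp_inj_on)
  have "map_prod ?\<rho> ?\<rho> ` R = R"
  proof (rule endo_inj_surj)
    have "R \<subseteq> ?K \<times> ?K" by (auto simp: R_def)
    then show "finite R"
      by (rule finite_subset) (simp add: irreducible_components_eq finite_classes)
    show "map_prod ?\<rho> ?\<rho> ` R \<subseteq> R"
      using component_map(1) component_le_image by (auto simp: R_def)
    show "inj_on (map_prod ?\<rho> ?\<rho>) R"
      using map_prod_inj_on[OF inj\<rho> inj\<rho>] \<open>R \<subseteq> ?K \<times> ?K\<close> by (rule inj_on_subset)
  qed
  moreover have "(?\<rho> C, ?\<rho> D) \<in> R" using CD le component_map(1) by (simp add: R_def)
  ultimately have "(?\<rho> C, ?\<rho> D) \<in> map_prod ?\<rho> ?\<rho> ` R" by simp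
  then obtain C' D' where "(C', D') \<in> R" "?\<rho> C' = ?\<rho> C" "?\<rho> D' = ?\<rho> D" by auto
  moreover from this have "C' = C" "D' = D"
    using inj_onD[OF inj\<rho>] CD by (auto simp: R_def)
  ultimately show "component_le A X C D" by (simp add: R_def)
qed

end

theorem proposition3p16:
  fixes A :: "'a set" and X :: "(int \<Rightarrow> 'a) set"
    and \<tau> :: "(int \<Rightarrow> 'a) \<Rightarrow> (int \<Rightarrow> 'a)"
    and \<C> :: "(int \<Rightarrow> 'a) set set"
    and \<rho> :: "(int \<Rightarrow> 'a) set \<Rightarrow> (int \<Rightarrow> 'a) set"
  defines "\<C> \<equiv> irreducible_components A X"
    and "\<rho> \<equiv> component_map A X \<tau>"
  assumes "finite A"
    and "subshift_of_finite_type A X"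
    and "subshift_endomorphism A X \<tau>"
    and "inj_on \<tau> X"
  shows "(\<tau> ` NW A X = NW A X \<and> topological_conjugacy A (NW A X) (NW A X) \<tau>) \<and>
    poset_automorphism \<C> (component_le A X) \<rho> \<and>
    (\<forall>C\<in>\<C>. \<tau> ` C = \<rho> C \<and> topological_conjugacy A C (\<rho> C) \<tau>) \<and>
    (\<tau> ` (X - NW A X) \<subseteq> X - NW A X \<and> {x \<in> X. \<tau> x \<in> X - NW A X} = X - NW A X) \<and>
    (\<tau> ` X = X \<longleftrightarrow> \<tau> ` (X - NW A X) = X - NW A X)"
proof -
  obtain N S where "X = {x \<in> topspace (full_shift A). \<forall>i. window N x i \<in> S}"
    using assms(4) unfolding subshift_of_finite_type_def window_def by blast
  then interpret injective_endomorphism A X N S \<tau>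
    using assms(3,5,6) by unfold_locales
  have NWX: "NW A X \<subseteq> X" by (auto simp: NW_iff)
  have iff: "\<tau> x \<in> NW A X \<longleftrightarrow> x \<in> NW A X" if "x \<in> X" for x
    using inj_on_image_mem_iff[OF inj that NWX] image_NW by simp
  have img_diff: "\<tau> ` (X - NW A X) = \<tau> ` X - NW A X"
    using inj_on_image_set_diff[OF inj, of X "NW A X"] NWX image_NW by auto
  show ?thesis
  proof (intro conjI ballI)
    show "\<tau> ` NW A X = NW A X" by (rule image_NW)
    show "topological_conjugacy A (NW A X) (NW A X) \<tau>"
      by (intro topological_conjugacy_image subshift_NW NWX image_NW)
    show "poset_automorphism \<C> (component_le A X) \<rho>"
      unfolding \<C>_def \<rho>_def by (rule poset_automorphism_component_map)
    show "\<tau> ` C = \<rho> C" if "C \<in> \<C>" for C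
      using that unfolding \<C>_def \<rho>_def by (rule image_component)
    show "topological_conjugacy A C (\<rho> C) \<tau>" if "C \<in> \<C>" for C
      using that component_subshift component_map(1) component_subset(2) image_component
      unfolding \<C>_def \<rho>_def by (intro topological_conjugacy_image) auto
    show "\<tau> ` (X - NW A X) \<subseteq> X - NW A X" using iff mem_image by auto
    show "{x \<in> X. \<tau> x \<in> X - NW A X} = X - NW A X" using iff mem_image by auto
    show "\<tau> ` X = X \<longleftrightarrow> \<tau> ` (X - NW A X) = X - NW A X"
      unfolding img_diff using NWX image_NW mem_image by blast
  qed
qed

end
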